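(* Let $\sigma>0$. Fix $m \in \mathbb{N}$. Assume the map $\theta \mapsto Q_\theta$ is continuous with respect to the weak topology. Then, for every $n \in \mathbb{N}$, there exists a measurable function $\omega\mapsto\hat\theta_n(\omega)$ such that for every $\omega\in\Omega$ $$\hat\theta_n(\omega) \in \mathop{\mathrm{argmin}}_{\theta \in \Theta} \mathbb{E} \big [ \mathsf{W}_1^{\sigma} ( P_n, Q_{\theta, m}) \,\big|\, X_{1:n} \big ](\omega),$$ and in particular this set of minimizers is nonempty.
   Context: $\mathcal{N}_\sigma=\mathcal N(0,\sigma^2 \mathrm{I}_d)$, $\mathsf{W}_1$ is the 1-Wasserstein distance on $\mathbb{R}^d$ (Euclidean cost) and $\mathsf{W}_1^{\sigma}(P,Q):=\mathsf{W}_1(P\ast\mathcal{N}_\sigma,Q\ast\mathcal{N}_\sigma)$. $\Theta\subset\mathbb{R}^{d_0}$ is compact with nonempty interior; $P$ and $Q_\theta$, $\theta\in\Theta$, are Borel probability measures on $\mathbb{R}^d$ with finite first moment. $X_{1:n}=(X_1,\dots,X_n)$ are i.i.d. from $P$ on a probability space $(\Omega,\mathcal{A},\mathbb{P})$, $P_n=n^{-1}\sum_{i=1}^n\delta_{X_i}$. $Q_{\theta,m}=m^{-1}\sum_{i=1}^m\delta_{Y_i}$ with $Y_1,\dots,Y_m$ i.i.d. from $Q_\theta$, independent of $X_{1:n}$; thus the conditional expectation given $X_{1:n}$ is the integral over $Y_1,\dots,Y_m$ (under $Q_\theta^{\otimes m}$) with $X_{1:n}$ fixed. *)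

theory Defs
  imports "HOL-Probability.Probability"
begin

definition borel_prob_measures :: "'a::topological_space measure set" where
  "borel_prob_measures = {\<mu>. prob_space \<mu> \<and> sets \<mu> = sets borel}"

text \<open>The coarsest topology on the Borel probability measures that makes
  \<open>\<mu> \<mapsto> \<integral> f d\<mu>\<close> continuous for every bounded continuous real function \<open>f\<close>.\<close>

definition weak_topology :: "'a::topological_space measure topology" where
  "weak_topology = topology_generated_by
     {{\<mu> \<in> borel_prob_measures. (\<integral>x. f x \<partial>\<mu>) \<in> U} | f U.
        continuous_on UNIV f \<and> bounded (range f) \<and> open (U :: real set)}"

lemma topspace_weak_topology: "topspace weak_topology = borel_prob_measures"
proof -
  have "borel_prob_measures = {\<mu> \<in> borel_prob_measures. (\<integral>x. (0::real) \<partial>\<mu>) \<in> UNIV}"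
    by simp
  moreover have "continuous_on UNIV (\<lambda>x. 0::real)" "bounded (range (\<lambda>x. 0::real))" "open (UNIV :: real set)"
    by auto
  ultimately show ?thesis
    unfolding weak_topology_def topology_generated_by_topspace by blast
qed

definition couplings :: "'a::topological_space measure \<Rightarrow> 'a measure \<Rightarrow> ('a \<times> 'a) measure set" where
  "couplings \<mu> \<nu> = {\<pi>. prob_space \<pi> \<and> sets \<pi> = sets (borel \<Otimes>\<^sub>M borel) \<and>
     distr \<pi> borel fst = \<mu> \<and> distr \<pi> borel snd = \<nu>}"

definition W1 :: "'a::metric_space measure \<Rightarrow> 'a measure \<Rightarrow> ennreal" where
  "W1 \<mu> \<nu> = (INF \<pi> \<in> couplings \<mu> \<nu>. \<integral>\<^sup>+z. ennreal (dist (fst z) (snd z)) \<partial>\<pi>)"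

text \<open>\<open>\<N>(0, \<sigma>\<^sup>2 I)\<close>: the coordinates are independent with law \<open>\<N>(0, \<sigma>\<^sup>2)\<close>. The second
  argument of \<^const>\<open>normal_density\<close> is the standard deviation.\<close>

definition gaussian :: "real \<Rightarrow> (real ^ 'd) measure" where
  "gaussian \<sigma> = density lborel (\<lambda>x. ennreal (\<Prod>i\<in>UNIV. normal_density 0 \<sigma> (x $ i)))"

lemma gaussian_density:
  fixes x :: "real ^ 'd"
  assumes "\<sigma> > 0"
  shows "(\<Prod>i\<in>UNIV. normal_density 0 \<sigma> (x $ i)) =
    exp (- (norm x)\<^sup>2 / (2 * \<sigma>\<^sup>2)) / sqrt (2 * pi * \<sigma>\<^sup>2) ^ CARD('d)"
proof -
  have "(norm x)\<^sup>2 = (\<Sum>i\<in>UNIV. (x $ i)\<^sup>2)"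
    by (simp add: norm_vec_def L2_set_def sum_nonneg)
  then have "exp (- (norm x)\<^sup>2 / (2 * \<sigma>\<^sup>2)) = (\<Prod>i\<in>UNIV. exp (- (x $ i)\<^sup>2 / (2 * \<sigma>\<^sup>2)))"
    by (simp add: exp_sum[symmetric] sum_divide_distrib sum_negf)
  then show ?thesis
    by (simp add: normal_density_def prod_dividef)
qed

definition smooth_W1 :: "real \<Rightarrow> (real ^ 'd) measure \<Rightarrow> (real ^ 'd) measure \<Rightarrow> ennreal" where
  "smooth_W1 \<sigma> \<mu> \<nu> = W1 (\<mu> \<star> gaussian \<sigma>) (\<nu> \<star> gaussian \<sigma>)"

definition empirical_measure :: "nat \<Rightarrow> (nat \<Rightarrow> 'a::topological_space) \<Rightarrow> 'a measure" where
  "empirical_measure n x = measure_of UNIV (sets borel)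
     (\<lambda>A. (\<Sum>i\<in>{1..n}. emeasure (return borel (x i)) A) / of_nat n)"

lemma sets_empirical_measure [simp, measurable_cong]:
  "sets (empirical_measure n x) = sets (borel :: 'a::topological_space measure)"
  by (simp add: empirical_measure_def sets.sigma_sets_eq[of borel, simplified])

lemma emeasure_empirical_measure:
  assumes "A \<in> sets (borel :: 'a::topological_space measure)"
  shows "emeasure (empirical_measure n x) A =
    (\<Sum>i\<in>{1..n}. emeasure (return borel (x i)) A) / of_nat n"
proof (rule emeasure_measure_of[OF empirical_measure_def])
  show "countably_additive (sets (empirical_measure n x))
      (\<lambda>A. (\<Sum>i\<in>{1..n}. emeasure (return borel (x i)) A) / of_nat n)"
  proof (rule countably_additiveI)
    fix B :: "nat \<Rightarrow> 'a set"
    assume B: "range B \<subseteq> sets (empirical_measure n x)" "disjoint_family B"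
    have "(\<Sum>k. emeasure (return borel (x i)) (B k)) = emeasure (return borel (x i)) (\<Union>k. B k)" for i
      using B by (intro suminf_emeasure) auto
    then show "(\<Sum>k. (\<Sum>i\<in>{1..n}. emeasure (return borel (x i)) (B k)) / of_nat n) =
        (\<Sum>i\<in>{1..n}. emeasure (return borel (x i)) (\<Union>k. B k)) / of_nat n"
      by (simp add: divide_ennreal_def suminf_sum[OF summableI])
  qed
qed (use assms in \<open>auto simp: positive_def\<close>)

text \<open>The expectation of the smooth distance between \<open>\<mu>\<close> and the empirical measure of \<open>m\<close>
  independent samples from \<open>\<nu>\<close>. With \<open>\<mu>\<close> the empirical measure of \<open>X\<^sub>1(\<omega>), \<dots>, X\<^sub>n(\<omega>)\<close>, this is the
  regular version at \<open>\<omega>\<close> of the conditional expectation given \<open>X\<^sub>1, \<dots>, X\<^sub>n\<close> when the samples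
  are independent of \<open>X\<^sub>1, \<dots>, X\<^sub>n\<close>.\<close>

definition expected_smooth_W1 ::
  "real \<Rightarrow> nat \<Rightarrow> (real ^ 'd) measure \<Rightarrow> (real ^ 'd) measure \<Rightarrow> ennreal" where
  "expected_smooth_W1 \<sigma> m \<mu> \<nu> =
     (\<integral>\<^sup>+y. smooth_W1 \<sigma> \<mu> (empirical_measure m y) \<partial>(\<Pi>\<^sub>M i\<in>{1..m}. \<nu>))"

definition argmin_set :: "('b \<Rightarrow> 'c::ord) \<Rightarrow> 'b set \<Rightarrow> 'b set" where
  "argmin_set f S = {x. is_arg_min f (\<lambda>y. y \<in> S) x}"

end

theory Submission
  imports Defs
begin

text \<open>The idea is to avoid both the gluing lemma and tightness. Moving the atoms of an empirical
  measure is realised, after smoothing, by an explicit transition kernel: a point \<open>a\<close> is assigned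
  to the atom \<open>x\<^sub>i\<close> with probability proportional to the Gaussian density at \<open>a - x\<^sub>i\<close>, and is shifted
  with that atom. Hence the smooth distance is Lipschitz in each atom of both empirical measures.
  The Lipschitz bound survives infima and integrals over the samples, so a Fatou lemma for weakly
  convergent measures and Lipschitz integrands shows, by induction on the sample size, that the
  objective is lower semicontinuous in \<open>\<theta>\<close>, while its infimum over any set of parameters
  depends measurably on the data. Comparing the infima over \<open>\<Theta> \<inter> C\<close> and \<open>\<Theta>\<close> decides
  measurably whether the minimizers meet a closed set \<open>C\<close>, and the lexicographically smallest
  minimizer is a measurable selection.\<close>

subsection \<open>Lipschitz dependence on the atoms\<close>

lemma nn_integral_empirical_measure:
  assumes n: "n \<ge> 1" and h: "h \<in> borel_measurable borel"
  shows "(\<integral>\<^sup>+z. h z \<partial>empirical_measure n x) = (\<Sum>i\<in>{1..n}. h (x i)) / of_nat n"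
proof -
  \<comment> \<open>Pushing the uniform law on the indices forward along \<open>x\<close> counts
    repeated atoms with multiplicity. The bound \<open>n \<ge> 1\<close> makes the index set
    nonempty, as \<open>pmf_of_set\<close> requires.\<close>
  have fin: "finite {1..n}" "{1..n} \<noteq> {}" using n by auto
  have "empirical_measure n x = distr (measure_pmf (pmf_of_set {1..n})) borel x"
  proof (rule measure_eqI)
    fix A assume "A \<in> sets (empirical_measure n x)"
    then have A: "A \<in> sets borel" by simp
    have "emeasure (distr (measure_pmf (pmf_of_set {1..n})) borel x) A
        = (\<integral>\<^sup>+z. indicator A z \<partial>distr (measure_pmf (pmf_of_set {1..n})) borel x)"
      using A by simp
    also have "\<dots> = (\<Sum>i\<in>{1..n}. indicator A (x i)) / of_nat n"
      using A fin by (subst nn_integral_distr) (auto simp: nn_integral_pmf_of_set)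
    also have "\<dots> = emeasure (empirical_measure n x) A"
      using A by (simp add: emeasure_empirical_measure)
    finally show "emeasure (empirical_measure n x) A
        = emeasure (distr (measure_pmf (pmf_of_set {1..n})) borel x) A" by simp
  qed simp
  then show ?thesis
    using fin h by (simp add: nn_integral_distr nn_integral_pmf_of_set)
qed

definition gauss_dens :: "real \<Rightarrow> real ^ 'd \<Rightarrow> real" where
  "gauss_dens \<sigma> x = (\<Prod>i\<in>UNIV. normal_density 0 \<sigma> (x $ i))"

lemma gauss_dens_pos: "\<sigma> > 0 \<Longrightarrow> gauss_dens \<sigma> x > 0"
  unfolding gauss_dens_def by (intro prod_pos) (auto intro: normal_density_pos)

lemma gauss_dens_measurable [measurable]: "gauss_dens \<sigma> \<in> borel_measurable borel"
  unfolding gauss_dens_def by measurable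

lemma gaussian_eq_density: "gaussian \<sigma> = density lborel (\<lambda>x. ennreal (gauss_dens \<sigma> x))"
  by (simp add: gaussian_def gauss_dens_def)

lemma nn_integral_lborel_plus:
  fixes c :: "'a::euclidean_space"
  assumes [measurable]: "h \<in> borel_measurable borel"
  shows "(\<integral>\<^sup>+z. h (c + z) \<partial>lborel) = (\<integral>\<^sup>+z. h z \<partial>lborel)"
proof -
  have "(\<integral>\<^sup>+z. h z \<partial>lborel) = (\<integral>\<^sup>+z. h z \<partial>distr lborel borel ((+) c))"
    by (simp only: lborel_distr_plus)
  also have "\<dots> = (\<integral>\<^sup>+z. h (c + z) \<partial>lborel)"
    by (rule nn_integral_distr) auto
  finally show ?thesis by simp
qed

text \<open>By Fubini, smoothing turns the atoms into an average of shifted Gaussians. The shift is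
  kept inside \<open>h\<close>, so changing the atoms leaves the weight
  \<open>gauss_dens \<sigma> z\<close> untouched.\<close>

lemma nn_integral_empirical_convolution_gaussian:
  fixes x :: "nat \<Rightarrow> real ^ 'd"
  assumes n: "n \<ge> 1" and h [measurable]: "h \<in> borel_measurable borel"
  shows "(\<integral>\<^sup>+z. h z \<partial>(empirical_measure n x \<star> gaussian \<sigma>))
    = (\<Sum>i\<in>{1..n}. \<integral>\<^sup>+z. ennreal (gauss_dens \<sigma> z) * h (x i + z) \<partial>lborel) / of_nat n"
proof -
  \<comment> \<open>A finite-valued density over the sigma-finite Lebesgue measure is again
    sigma-finite, which is what Fubini asks for.\<close>
  interpret G: sigma_finite_measure "gaussian \<sigma> :: (real^'d) measure"
    unfolding gaussian_eq_density
    by (subst sigma_finite_measure.sigma_finite_iff_density_finite) (auto intro: sigma_finite_lborel)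
  have [measurable_cong]: "sets (gaussian \<sigma> :: (real^'d) measure) = sets borel"
    by (simp add: gaussian_def)
  have "(\<integral>\<^sup>+z. h z \<partial>(empirical_measure n x \<star> gaussian \<sigma>))
      = (\<integral>\<^sup>+z. h (fst z + snd z) \<partial>(empirical_measure n x \<Otimes>\<^sub>M gaussian \<sigma>))"
    unfolding convolution_def by (subst nn_integral_distr) (auto simp: split_beta')
  also have "\<dots> = (\<integral>\<^sup>+a. \<integral>\<^sup>+z. h (a + z) \<partial>gaussian \<sigma> \<partial>empirical_measure n x)"
    by (subst G.nn_integral_fst[symmetric]) auto
  also have "\<dots> = (\<Sum>i\<in>{1..n}. \<integral>\<^sup>+z. h (x i + z) \<partial>gaussian \<sigma>) / of_nat n"
    by (rule nn_integral_empirical_measure[OF n]) measurable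
  also have "(\<lambda>i. \<integral>\<^sup>+z. h (x i + z) \<partial>gaussian \<sigma>)
      = (\<lambda>i. \<integral>\<^sup>+z. ennreal (gauss_dens \<sigma> z) * h (x i + z) \<partial>lborel)"
    unfolding gaussian_eq_density by (subst nn_integral_density) auto
  finally show ?thesis .
qed

section \<open>Symmetry of the Wasserstein distance\<close>

lemma couplings_swap:
  fixes \<mu> \<nu> :: "'a::topological_space measure"
  assumes "\<pi> \<in> couplings \<mu> \<nu>"
  shows "distr \<pi> (borel \<Otimes>\<^sub>M borel) prod.swap \<in> couplings \<nu> \<mu>"
proof -
  have [measurable_cong]: "sets \<pi> = sets (borel \<Otimes>\<^sub>M borel)" and p: "prob_space \<pi>"
    and m: "distr \<pi> borel fst = \<mu>" "distr \<pi> borel snd = \<nu>"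
    using assms by (auto simp: couplings_def)
  have [measurable]: "prod.swap \<in> \<pi> \<rightarrow>\<^sub>M (borel \<Otimes>\<^sub>M borel)"
    unfolding prod.swap_def by measurable
  have "distr (distr \<pi> (borel \<Otimes>\<^sub>M borel) prod.swap) borel fst = \<nu>"
    using m by (subst distr_distr) (auto simp: o_def)
  moreover have "distr (distr \<pi> (borel \<Otimes>\<^sub>M borel) prod.swap) borel snd = \<mu>"
    using m by (subst distr_distr) (auto simp: o_def)
  ultimately show ?thesis
    using p by (auto simp: couplings_def intro!: prob_space.prob_space_distr)
qed

text \<open>Swapping coordinates preserves the cost of a coupling. The resulting symmetry later
  carries the Lipschitz bound from the first empirical measure over to the second.\<close>

lemma W1_commute_le:
  fixes \<mu> \<nu> :: "'a::{metric_space,second_countable_topology} measure"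
  shows "W1 \<mu> \<nu> \<le> W1 \<nu> \<mu>"
  unfolding W1_def
proof (rule INF_mono)
  fix \<pi> assume pi: "\<pi> \<in> couplings \<nu> \<mu>"
  then have [measurable_cong]: "sets \<pi> = sets (borel \<Otimes>\<^sub>M borel)" by (auto simp: couplings_def)
  have [measurable]: "prod.swap \<in> \<pi> \<rightarrow>\<^sub>M (borel \<Otimes>\<^sub>M borel)"
    unfolding prod.swap_def by measurable
  have "(\<integral>\<^sup>+z. ennreal (dist (fst z) (snd z)) \<partial>distr \<pi> (borel \<Otimes>\<^sub>M borel) prod.swap)
     = (\<integral>\<^sup>+z. ennreal (dist (fst z) (snd z)) \<partial>\<pi>)"
    by (subst nn_integral_distr) (auto simp: dist_commute)
  with couplings_swap[OF pi] show "\<exists>\<pi>'\<in>couplings \<mu> \<nu>.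
      (\<integral>\<^sup>+z. ennreal (dist (fst z) (snd z)) \<partial>\<pi>') \<le> (\<integral>\<^sup>+z. ennreal (dist (fst z) (snd z)) \<partial>\<pi>)"
    by (intro bexI[of _ "distr \<pi> (borel \<Otimes>\<^sub>M borel) prod.swap"]) auto
qed

lemma W1_commute:
  fixes \<mu> \<nu> :: "'a::{metric_space,second_countable_topology} measure"
  shows "W1 \<mu> \<nu> = W1 \<nu> \<mu>"
  by (intro antisym W1_commute_le)

text \<open>Gluing along an explicit finite transition kernel: the point \<open>a\<close> is moved to \<open>T i a\<close>
  with probability \<open>w i a\<close>. This replaces the disintegration needed for the
  triangle inequality of general couplings.\<close>

lemma W1_le_finite_kernel:
  fixes \<mu> \<mu>' \<nu> :: "'a::{metric_space,second_countable_topology} measure"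
  assumes I: "finite I"
    and w [measurable]: "\<And>i. i \<in> I \<Longrightarrow> w i \<in> borel_measurable borel"
    and w1: "\<And>a. (\<Sum>i\<in>I. w i a) = (1::ennreal)"
    and T [measurable]: "\<And>i. i \<in> I \<Longrightarrow> T i \<in> borel_measurable borel"
    and sets: "sets \<mu>' = sets borel"
    and push: "\<And>A. A \<in> sets borel \<Longrightarrow>
      (\<integral>\<^sup>+a. indicator A a \<partial>\<mu>') = (\<Sum>i\<in>I. \<integral>\<^sup>+a. w i a * indicator A (T i a) \<partial>\<mu>)"
    and dist: "\<And>i a. i \<in> I \<Longrightarrow> dist (T i a) a \<le> c i"
  shows "W1 \<mu>' \<nu> \<le> W1 \<mu> \<nu> + (\<Sum>i\<in>I. ennreal (c i))"
proof -
  have c0: "0 \<le> c i" if "i \<in> I" for i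
    using dist[OF that] zero_le_dist order_trans by blast
  have fin: "(\<Sum>i\<in>I. ennreal (c i)) \<noteq> \<top>"
    using I by simp
  \<comment> \<open>The error is subtracted on the left so that the infimum over couplings can be
    taken on the right; its finiteness lets it be added back at the end.\<close>
  have "W1 \<mu>' \<nu> - (\<Sum>i\<in>I. ennreal (c i)) \<le> (\<integral>\<^sup>+z. ennreal (dist (fst z) (snd z)) \<partial>\<pi>)"
    if pi: "\<pi> \<in> couplings \<mu> \<nu>" for \<pi>
  proof -
    have sp [measurable_cong]: "sets \<pi> = sets (borel \<Otimes>\<^sub>M borel)" and p: "prob_space \<pi>"
      and m: "distr \<pi> borel fst = \<mu>" "distr \<pi> borel snd = \<nu>"
      using pi by (auto simp: couplings_def)
    interpret p: prob_space \<pi> by (rule p)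
    \<comment> \<open>\<open>D\<close> is the joint law of a pair drawn from \<open>\<pi>\<close>
      and an index \<open>i\<close> drawn with probability \<open>w i\<close> at its first
      coordinate. \<open>S\<close> moves the first coordinate by \<open>T i\<close>, keeps the
      second and forgets the index.\<close>
    define D where "D = density (count_space I \<Otimes>\<^sub>M \<pi>) (\<lambda>(i, z). w i (fst z))"
    define S where "S = (\<lambda>(i, z). (T i (fst z), snd z :: 'a))"
    define \<pi>' where "\<pi>' = distr D (borel \<Otimes>\<^sub>M borel) S"
    \<comment> \<open>With countably many indices, joint measurability can be checked at each fixed
      index.\<close>
    have cI: "countable I" using I by (rule countable_finite)
    have wm [measurable]: "(\<lambda>(i, z). w i (fst z)) \<in> borel_measurable (count_space I \<Otimes>\<^sub>M \<pi>)"
      by (rule measurable_pair_measure_countable1[OF cI]) simp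
    have "S \<in> (count_space I \<Otimes>\<^sub>M \<pi>) \<rightarrow>\<^sub>M (borel \<Otimes>\<^sub>M borel)"
      unfolding S_def by (rule measurable_pair_measure_countable1[OF cI]) simp
    then have Sm [measurable]: "S \<in> D \<rightarrow>\<^sub>M (borel \<Otimes>\<^sub>M borel)"
      and Sm' [measurable]: "S \<in> (count_space I \<Otimes>\<^sub>M \<pi>) \<rightarrow>\<^sub>M (borel \<Otimes>\<^sub>M borel)"
      by (auto simp: D_def)
    have int: "(\<integral>\<^sup>+z. h z \<partial>\<pi>') = (\<Sum>i\<in>I. \<integral>\<^sup>+z. w i (fst z) * h (T i (fst z), snd z) \<partial>\<pi>)"
      if [measurable]: "h \<in> borel_measurable (borel \<Otimes>\<^sub>M borel)" for h
    proof -
      have "(\<integral>\<^sup>+z. h z \<partial>\<pi>') = (\<integral>\<^sup>+u. h (S u) \<partial>D)"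
        unfolding \<pi>'_def by (rule nn_integral_distr) auto
      also have "\<dots> = (\<integral>\<^sup>+u. (case u of (i, z) \<Rightarrow> w i (fst z)) * h (S u) \<partial>(count_space I \<Otimes>\<^sub>M \<pi>))"
        unfolding D_def by (rule nn_integral_density) auto
      also have "\<dots> = (\<integral>\<^sup>+i. \<integral>\<^sup>+z. w i (fst z) * h (T i (fst z), snd z) \<partial>\<pi> \<partial>count_space I)"
      proof -
        have "(\<lambda>u. (case u of (i, z) \<Rightarrow> w i (fst z)) * h (S u)) \<in> borel_measurable (count_space I \<Otimes>\<^sub>M \<pi>)"
          by measurable
        then show ?thesis
          by (subst p.nn_integral_fst[symmetric]) (auto simp: S_def)
      qed
      also have "\<dots> = (\<Sum>i\<in>I. \<integral>\<^sup>+z. w i (fst z) * h (T i (fst z), snd z) \<partial>\<pi>)"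
        by (rule nn_integral_count_space_finite[OF I])
      finally show ?thesis .
    qed
    have sp' [measurable_cong]: "sets \<pi>' = sets (borel \<Otimes>\<^sub>M borel)" by (simp add: \<pi>'_def)
    have spc: "space \<pi>' = UNIV" by (simp add: \<pi>'_def space_pair_measure)
    \<comment> \<open>Since the weights sum to one pointwise, integrands that ignore the index are
      integrated as under \<open>\<pi>\<close>. This yields the total mass, the second marginal and
      the main term of the cost.\<close>
    have wsum: "(\<Sum>i\<in>I. \<integral>\<^sup>+z. w i (fst z) * h z \<partial>\<pi>) = (\<integral>\<^sup>+z. h z \<partial>\<pi>)"
      if [measurable]: "h \<in> borel_measurable \<pi>" for h
      by (subst nn_integral_sum[symmetric]) (auto simp: sum_distrib_right[symmetric] w1)
    have "prob_space \<pi>'"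
    proof
      have "emeasure \<pi>' (space \<pi>') = (\<integral>\<^sup>+z. 1 \<partial>\<pi>')" by simp
      also have "\<dots> = 1"
        using int[of "\<lambda>_. 1"] wsum[of "\<lambda>_. 1"] by (simp add: p.emeasure_space_1)
      finally show "emeasure \<pi>' (space \<pi>') = 1" .
    qed
    moreover have "distr \<pi>' borel fst = \<mu>'"
    proof (rule measure_eqI)
      fix A :: "'a set" assume "A \<in> sets (distr \<pi>' borel fst)"
      then have A [measurable]: "A \<in> sets borel" by simp
      have "emeasure (distr \<pi>' borel fst) A = (\<integral>\<^sup>+a. indicator A a \<partial>distr \<pi>' borel fst)"
        by simp
      also have "\<dots> = (\<integral>\<^sup>+z. indicator A (fst z) \<partial>\<pi>')"
        by (rule nn_integral_distr) auto
      also have "\<dots> = (\<Sum>i\<in>I. \<integral>\<^sup>+z. w i (fst z) * indicator A (T i (fst z)) \<partial>\<pi>)"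
        by (subst int) auto
      also have "\<dots> = (\<Sum>i\<in>I. \<integral>\<^sup>+a. w i a * indicator A (T i a) \<partial>\<mu>)"
        unfolding m(1)[symmetric] by (intro sum.cong refl, subst nn_integral_distr) auto
      also have "\<dots> = (\<integral>\<^sup>+a. indicator A a \<partial>\<mu>')" by (rule push[symmetric]) simp
      also have "\<dots> = emeasure \<mu>' A" by (simp add: sets)
      finally show "emeasure (distr \<pi>' borel fst) A = emeasure \<mu>' A" .
    qed (simp add: sets)
    moreover have "distr \<pi>' borel snd = \<nu>"
    proof (rule measure_eqI)
      fix A :: "'a set" assume "A \<in> sets (distr \<pi>' borel snd)"
      then have A [measurable]: "A \<in> sets borel" by simp
      have "emeasure (distr \<pi>' borel snd) A = (\<integral>\<^sup>+a. indicator A a \<partial>distr \<pi>' borel snd)"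
        by simp
      also have "\<dots> = (\<integral>\<^sup>+z. indicator A (snd z) \<partial>\<pi>')"
        by (rule nn_integral_distr) auto
      also have "\<dots> = (\<Sum>i\<in>I. \<integral>\<^sup>+z. w i (fst z) * indicator A (snd z) \<partial>\<pi>)"
        by (subst int) auto
      also have "\<dots> = (\<integral>\<^sup>+z. indicator A (snd z) \<partial>\<pi>)"
        by (rule wsum) auto
      also have "\<dots> = (\<integral>\<^sup>+a. indicator A a \<partial>distr \<pi> borel snd)"
        by (rule nn_integral_distr[symmetric]) auto
      also have "\<dots> = emeasure \<nu> A" by (simp add: m(2)[symmetric])
      finally show "emeasure (distr \<pi>' borel snd) A = emeasure \<nu> A" .
    qed (use m(2) in auto)
    ultimately have "\<pi>' \<in> couplings \<mu>' \<nu>"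
      by (simp add: couplings_def sp')
    then have "W1 \<mu>' \<nu> \<le> (\<integral>\<^sup>+z. ennreal (dist (fst z) (snd z)) \<partial>\<pi>')"
      unfolding W1_def by (rule INF_lower)
    also have "\<dots> = (\<Sum>i\<in>I. \<integral>\<^sup>+z. w i (fst z) * ennreal (dist (T i (fst z)) (snd z)) \<partial>\<pi>)"
      by (subst int) auto
    \<comment> \<open>The shift is charged with weight 1 instead of \<open>w i\<close>. The sum of
      all \<open>c i\<close> is cruder than the mean displacement, but it still vanishes as the
      shifts do.\<close>
    also have "\<dots> \<le> (\<Sum>i\<in>I. \<integral>\<^sup>+z. (w i (fst z) * ennreal (dist (fst z) (snd z)) + ennreal (c i)) \<partial>\<pi>)"
    proof (intro sum_mono nn_integral_mono)
      fix i and z :: "'a \<times> 'a" assume i: "i \<in> I"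
      have wle: "w i (fst z) \<le> 1"
        using member_le_sum[OF i _ I, of "\<lambda>i. w i (fst z)"] w1 by simp
      have "dist (T i (fst z)) (snd z) \<le> dist (fst z) (snd z) + c i"
        using dist_triangle[of "T i (fst z)" "snd z" "fst z"] dist[OF i, of "fst z"] by simp
      then have "ennreal (dist (T i (fst z)) (snd z)) \<le> ennreal (dist (fst z) (snd z)) + ennreal (c i)"
        using c0[OF i] by (simp add: ennreal_plus[symmetric] ennreal_leI del: ennreal_plus)
      then have "w i (fst z) * ennreal (dist (T i (fst z)) (snd z))
          \<le> w i (fst z) * (ennreal (dist (fst z) (snd z)) + ennreal (c i))"
        by (rule mult_left_mono) simp
      also have "\<dots> \<le> w i (fst z) * ennreal (dist (fst z) (snd z)) + ennreal (c i)"
        using mult_right_mono[OF wle, of "ennreal (c i)"] by (simp add: distrib_left add_left_mono)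
      finally show "w i (fst z) * ennreal (dist (T i (fst z)) (snd z))
          \<le> w i (fst z) * ennreal (dist (fst z) (snd z)) + ennreal (c i)" .
    qed
    also have "\<dots> = (\<Sum>i\<in>I. (\<integral>\<^sup>+z. w i (fst z) * ennreal (dist (fst z) (snd z)) \<partial>\<pi>) + ennreal (c i))"
      by (intro sum.cong refl, subst nn_integral_add) (auto simp: p.emeasure_space_1)
    also have "\<dots> = (\<integral>\<^sup>+z. ennreal (dist (fst z) (snd z)) \<partial>\<pi>) + (\<Sum>i\<in>I. ennreal (c i))"
      by (simp add: sum.distrib wsum)
    finally show ?thesis
      using fin by (simp add: ennreal_minus_le_iff add.commute)
  qed
  then have "W1 \<mu>' \<nu> - (\<Sum>i\<in>I. ennreal (c i)) \<le> W1 \<mu> \<nu>"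
    unfolding W1_def[of \<mu> \<nu>] by (rule INF_greatest)
  with fin show ?thesis
    by (simp add: ennreal_minus_le_iff add.commute)
qed

text \<open>The weights are Bayes posteriors: \<open>w i a\<close> is the probability that a point
  found at \<open>a\<close> came from atom \<open>i\<close>. Weighting by the posterior isolates the
  Gaussian around \<open>x i\<close>, and a translation carries it to \<open>x' i\<close>.\<close>

lemma W1_empirical_convolution_gaussian_Lipschitz:
  fixes x x' :: "nat \<Rightarrow> real ^ 'd"
  assumes n: "n \<ge> 1" and \<sigma>: "\<sigma> > 0"
  shows "W1 (empirical_measure n x' \<star> gaussian \<sigma>) \<nu>
    \<le> W1 (empirical_measure n x \<star> gaussian \<sigma>) \<nu> + (\<Sum>i\<in>{1..n}. ennreal (dist (x' i) (x i)))"
proof -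
  define g where "g = (gauss_dens \<sigma> :: real ^ 'd \<Rightarrow> real)"
  have [measurable]: "g \<in> borel_measurable borel" by (simp add: g_def)
  have gpos: "g z > 0" for z using \<sigma> by (simp add: g_def gauss_dens_pos)
  \<comment> \<open>Up to the factor \<open>1 / n\<close>, \<open>s\<close> is the Lebesgue density
    of the smoothed measure. It is positive everywhere, so the posterior is a genuine quotient at
    every point.\<close>
  define s where "s a = (\<Sum>k\<in>{1..n}. g (a - x k))" for a
  have spos: "s a > 0" for a
    unfolding s_def using n by (intro sum_pos) (auto simp: gpos)
  have [measurable]: "s \<in> borel_measurable borel" unfolding s_def by measurable
  define w where "w i a = ennreal (g (a - x i) / s a)" for i a
  have [measurable]: "w i \<in> borel_measurable borel" for i unfolding w_def by measurable
  define T where "T i a = a + (x' i - x i)" for i a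
  have [measurable]: "T i \<in> borel_measurable borel" for i unfolding T_def by measurable
  have dens: "(\<integral>\<^sup>+z. h z \<partial>(empirical_measure n x \<star> gaussian \<sigma>))
      = (\<integral>\<^sup>+a. ennreal (s a) * h a \<partial>lborel) / of_nat n"
    if [measurable]: "h \<in> borel_measurable borel" for h
  proof -
    have "(\<Sum>i\<in>{1..n}. \<integral>\<^sup>+z. ennreal (g z) * h (x i + z) \<partial>lborel)
        = (\<Sum>i\<in>{1..n}. \<integral>\<^sup>+a. ennreal (g (a - x i)) * h a \<partial>lborel)"
    proof (intro sum.cong refl)
      fix i
      \<comment> \<open>The substitution \<open>a = x i + z\<close> brings all components to a
        common variable.\<close>
      show "(\<integral>\<^sup>+z. ennreal (g z) * h (x i + z) \<partial>lborel) = (\<integral>\<^sup>+a. ennreal (g (a - x i)) * h a \<partial>lborel)"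
        using nn_integral_lborel_plus[of "\<lambda>a. ennreal (g (a - x i)) * h a" "x i"] by simp
    qed
    also have "\<dots> = (\<integral>\<^sup>+a. (\<Sum>i\<in>{1..n}. ennreal (g (a - x i)) * h a) \<partial>lborel)"
      by (rule nn_integral_sum[symmetric]) simp
    also have "\<dots> = (\<integral>\<^sup>+a. ennreal (s a) * h a \<partial>lborel)"
      by (simp add: s_def sum_distrib_right[symmetric] sum_ennreal less_imp_le[OF gpos])
    finally show ?thesis
      using nn_integral_empirical_convolution_gaussian[OF n that] by (simp add: g_def)
  qed
  show ?thesis
  proof (rule W1_le_finite_kernel[where w = w and T = T])
    show "(\<Sum>i\<in>{1..n}. w i a) = 1" for a
    proof -
      have "(\<Sum>i\<in>{1..n}. w i a) = ennreal (\<Sum>i\<in>{1..n}. g (a - x i) / s a)"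
        unfolding w_def using spos[of a] gpos by (intro sum_ennreal) (simp add: less_imp_le)
      also have "(\<Sum>i\<in>{1..n}. g (a - x i) / s a) = s a / s a"
        by (simp only: s_def sum_divide_distrib)
      finally show ?thesis using spos[of a] by simp
    qed
    show "(\<integral>\<^sup>+a. indicator A a \<partial>(empirical_measure n x' \<star> gaussian \<sigma>))
      = (\<Sum>i\<in>{1..n}. \<integral>\<^sup>+a. w i a * indicator A (T i a) \<partial>(empirical_measure n x \<star> gaussian \<sigma>))"
      if [measurable]: "A \<in> sets borel" for A
    proof -
      have "(\<integral>\<^sup>+a. w i a * indicator A (T i a) \<partial>(empirical_measure n x \<star> gaussian \<sigma>))
          = (\<integral>\<^sup>+z. ennreal (g z) * indicator A (x' i + z) \<partial>lborel) / of_nat n" for i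
      proof -
        have "(\<integral>\<^sup>+a. w i a * indicator A (T i a) \<partial>(empirical_measure n x \<star> gaussian \<sigma>))
          = (\<integral>\<^sup>+a. ennreal (s a) * (w i a * indicator A (T i a)) \<partial>lborel) / of_nat n"
          by (rule dens) measurable
        also have "(\<lambda>a. ennreal (s a) * (w i a * indicator A (T i a)))
            = (\<lambda>a. ennreal (g (a - x i)) * indicator A (T i a))"
        proof
          fix a
          \<comment> \<open>The density cancels the denominator of the posterior and only component
            \<open>i\<close> is left.\<close>
          have "ennreal (s a) * w i a = ennreal (g (a - x i))"
            using spos[of a] gpos[of "a - x i"] by (simp add: w_def ennreal_mult[symmetric])
          then show "ennreal (s a) * (w i a * indicator A (T i a))
              = ennreal (g (a - x i)) * indicator A (T i a)"
            by (simp add: mult.assoc[symmetric])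
        qed
        \<comment> \<open>At \<open>a = x i + z\<close> the moved point \<open>T i a\<close> is
          \<open>x' i + z\<close>.\<close>
        also have "(\<integral>\<^sup>+a. ennreal (g (a - x i)) * indicator A (T i a) \<partial>lborel)
            = (\<integral>\<^sup>+z. ennreal (g z) * indicator A (x' i + z) \<partial>lborel)"
          using nn_integral_lborel_plus[of "\<lambda>a. ennreal (g (a - x i)) * indicator A (T i a)" "x i"]
          by (simp add: T_def algebra_simps)
        finally show ?thesis .
      qed
      then show ?thesis
        using nn_integral_empirical_convolution_gaussian[OF n, of "indicator A" x' \<sigma>]
        by (simp add: g_def divide_ennreal_def sum_distrib_right)
    qed
    show "dist (T i a) a \<le> dist (x' i) (x i)" for i a
      by (simp add: T_def dist_norm)
  qed auto
qed

subsection \<open>Lower semicontinuity under weak convergence\<close>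

text \<open>The additive form in \<open>ennreal\<close> admits infinite values and avoids
  differences. The points range over all functions, although only coordinates in \<open>I\<close>
  enter the bound.\<close>

definition coord_Lipschitz :: "'i set \<Rightarrow> (('i \<Rightarrow> 'a::metric_space) \<Rightarrow> ennreal) \<Rightarrow> bool" where
  "coord_Lipschitz I f \<longleftrightarrow> (\<forall>x y. f x \<le> f y + (\<Sum>i\<in>I. ennreal (dist (x i) (y i))))"

lemma coord_LipschitzD:
  "coord_Lipschitz I f \<Longrightarrow> f x \<le> f y + (\<Sum>i\<in>I. ennreal (dist (x i) (y i)))"
  by (simp add: coord_Lipschitz_def)

text \<open>Coordinates outside \<open>I\<close> cost nothing, so the values there, such as
  \<open>undefined\<close> on a product space, are immaterial.\<close>

lemma coord_Lipschitz_cong: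
  assumes f: "coord_Lipschitz I f" and eq: "\<And>i. i \<in> I \<Longrightarrow> x i = y i"
  shows "f x = f y"
  using coord_LipschitzD[OF f, of x y] coord_LipschitzD[OF f, of y x] eq
  by (auto intro!: antisym)

text \<open>The bound is the same for every member of the family, hence it survives an infimum over
  any index set, even an uncountable one, where measurability alone could be lost.\<close>

lemma coord_Lipschitz_INF:
  fixes f :: "'j \<Rightarrow> ('i \<Rightarrow> 'a::metric_space) \<Rightarrow> ennreal"
  assumes "\<And>j. j \<in> J \<Longrightarrow> coord_Lipschitz I (f j)"
  shows "coord_Lipschitz I (\<lambda>x. INF j\<in>J. f j x)"
  unfolding coord_Lipschitz_def
proof (intro allI)
  fix x y :: "'i \<Rightarrow> 'a"
  let ?d = "\<Sum>i\<in>I. ennreal (dist (x i) (y i))"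
  have "(INF j\<in>J. f j x) - ?d \<le> (INF j\<in>J. f j y)"
  proof (rule INF_greatest)
    fix j assume j: "j \<in> J"
    then have "(INF j\<in>J. f j x) \<le> f j x" by (rule INF_lower)
    also have "\<dots> \<le> f j y + ?d" using assms[OF j] by (rule coord_LipschitzD)
    finally show "(INF j\<in>J. f j x) - ?d \<le> f j y"
      by (simp add: ennreal_minus_le_iff add.commute)
  qed
  then show "(INF j\<in>J. f j x) \<le> (INF j\<in>J. f j y) + ?d"
    by (simp add: ennreal_minus_le_iff add.commute)
qed

text \<open>Total mass one means that the constant error term integrates to itself.\<close>

lemma coord_Lipschitz_nn_integral:
  fixes f :: "'z \<Rightarrow> ('i \<Rightarrow> 'a::metric_space) \<Rightarrow> ennreal"
  assumes f: "\<And>z. coord_Lipschitz I (f z)" and M: "prob_space M"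
    and meas: "\<And>x. (\<lambda>z. f z x) \<in> borel_measurable M"
  shows "coord_Lipschitz I (\<lambda>x. \<integral>\<^sup>+z. f z x \<partial>M)"
  unfolding coord_Lipschitz_def
proof (intro allI)
  fix x y :: "'i \<Rightarrow> 'a"
  let ?d = "\<Sum>i\<in>I. ennreal (dist (x i) (y i))"
  have "(\<integral>\<^sup>+z. f z x \<partial>M) \<le> (\<integral>\<^sup>+z. (f z y + ?d) \<partial>M)"
    by (intro nn_integral_mono coord_LipschitzD[OF f])
  also have "\<dots> = (\<integral>\<^sup>+z. f z y \<partial>M) + ?d"
    using meas by (subst nn_integral_add) (auto simp: prob_space.emeasure_space_1[OF M])
  finally show "(\<integral>\<^sup>+z. f z x \<partial>M) \<le> (\<integral>\<^sup>+z. f z y \<partial>M) + ?d" .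
qed

text \<open>The bound makes strict sublevel sets open in the product topology. Countably many second
  countable factors make its Borel sets those of the product sigma-algebra.\<close>

lemma coord_Lipschitz_measurable:
  fixes f :: "('i::countable \<Rightarrow> 'a::{metric_space,second_countable_topology}) \<Rightarrow> ennreal"
  assumes f: "coord_Lipschitz I f" and I: "finite I"
    and Y: "\<And>i. i \<in> I \<Longrightarrow> Y i \<in> N \<rightarrow>\<^sub>M borel"
  shows "(\<lambda>w. f (\<lambda>i. Y i w)) \<in> borel_measurable N"
proof -
  have "f \<in> borel_measurable borel"
  proof (rule borel_measurableI_less)
    fix c
    have "open {x. f x < c}"
    proof (rule Topological_Spaces.openI)
      fix x assume "x \<in> {x. f x < c}"
      then have x: "f x < c" by simp
      then obtain e where e: "f x < e" "e < c" using dense by blast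
      \<comment> \<open>The Lipschitz bound at \<open>x\<close> is a continuous majorant of
        \<open>f\<close> that equals \<open>f x\<close> at \<open>x\<close>, so it stays below
        \<open>c\<close> on a neighbourhood.\<close>
      have "continuous_on UNIV (\<lambda>y. \<Sum>i\<in>I. dist (y i) (x i))"
        by (intro continuous_intros continuous_on_product_coordinates)
      then have cont: "continuous_on UNIV (\<lambda>y. f x + (\<Sum>i\<in>I. ennreal (dist (y i) (x i))))"
        by (auto intro!: continuous_intros continuous_on_ennreal)
      have "open ((\<lambda>y. f x + (\<Sum>i\<in>I. ennreal (dist (y i) (x i)))) -` {..<c})"
        using cont by (intro open_vimage) auto
      moreover have "x \<in> (\<lambda>y. f x + (\<Sum>i\<in>I. ennreal (dist (y i) (x i)))) -` {..<c}"
        using x by simp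
      moreover have "(\<lambda>y. f x + (\<Sum>i\<in>I. ennreal (dist (y i) (x i)))) -` {..<c} \<subseteq> {x. f x < c}"
        using coord_LipschitzD[OF f] by (auto intro: le_less_trans)
      ultimately show "\<exists>T. open T \<and> x \<in> T \<and> T \<subseteq> {x. f x < c}" by blast
    qed
    then show "{x \<in> space borel. f x < c} \<in> sets borel" by simp
  qed
  then have fm: "f \<in> borel_measurable (Pi\<^sub>M UNIV (\<lambda>_. borel))"
    by (simp add: measurable_def sets_PiM_equal_borel space_PiM)
  \<comment> \<open>Measurability of \<open>Y i\<close> is known for \<open>i \<in> I\<close> only;
    a constant elsewhere changes no value of \<open>f\<close>.\<close>
  define Z where "Z w = (\<lambda>i. if i \<in> I then Y i w else undefined)" for w
  have "Z \<in> N \<rightarrow>\<^sub>M Pi\<^sub>M UNIV (\<lambda>_. borel)"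
  proof (rule measurable_PiM_single')
    show "(\<lambda>w. Z w i) \<in> N \<rightarrow>\<^sub>M borel" for i
      using Y by (cases "i \<in> I") (auto simp: Z_def)
  qed auto
  with fm have "(\<lambda>w. f (Z w)) \<in> borel_measurable N" by simp
  moreover have "f (Z w) = f (\<lambda>i. Y i w)" for w
    by (rule coord_Lipschitz_cong[OF f]) (simp add: Z_def)
  ultimately show ?thesis by simp
qed

section \<open>Weak convergence and Fatou inequalities\<close>

definition weakly_converges :: "(nat \<Rightarrow> 'a::topological_space measure) \<Rightarrow> 'a measure \<Rightarrow> bool" where
  "weakly_converges \<nu>s \<nu> \<longleftrightarrow> (\<forall>h :: 'a \<Rightarrow> real. continuous_on UNIV h \<and> bounded (range h) \<longrightarrow>
     (\<lambda>k. \<integral>x. h x \<partial>\<nu>s k) \<longlonglongrightarrow> (\<integral>x. h x \<partial>\<nu>))"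

text \<open>Truncation of \<open>g\<close> at level \<open>N\<close> gives a bounded Lipschitz test
  function, for which weak convergence yields a limit; monotone convergence in \<open>N\<close> then
  recovers \<open>g\<close>.\<close>

lemma weakly_converges_liminf_Lipschitz:
  fixes g :: "'a::{metric_space,second_countable_topology} \<Rightarrow> ennreal"
  assumes conv: "weakly_converges \<nu>s \<nu>"
    and \<nu>s: "\<And>k. \<nu>s k \<in> borel_prob_measures" and \<nu>: "\<nu> \<in> borel_prob_measures"
    and g: "\<And>x y. g x \<le> g y + ennreal (dist x y)"
  shows "(\<integral>\<^sup>+x. g x \<partial>\<nu>) \<le> liminf (\<lambda>k. \<integral>\<^sup>+x. g x \<partial>\<nu>s k)"
proof -
  define h where "h N x = enn2real (min (g x) (of_nat N))" for N :: nat and x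
  have hg: "ennreal (h N x) = min (g x) (of_nat N)" for N x
    unfolding h_def
    by (rule ennreal_enn2real) (auto simp: min_less_iff_disj of_nat_less_top)
  have h0: "h N x \<ge> 0" for N x by (simp add: h_def)
  have hN: "h N x \<le> real N" for N x
  proof -
    have "ennreal (h N x) \<le> ennreal (real N)"
      by (simp add: hg ennreal_of_nat_eq_real_of_nat)
    then show ?thesis by (simp add: ennreal_le_iff)
  qed
  have hL: "h N x \<le> h N y + dist x y" for N x y
  proof -
    have "min (g x) (of_nat N) \<le> min (g y) (of_nat N) + ennreal (dist x y)"
      using g[of x y] by (auto simp: min_def intro: order_trans add_increasing2)
    then have "ennreal (h N x) \<le> ennreal (h N y + dist x y)"
      by (simp add: hg h0)
    then show ?thesis using h0[of N y] by (subst (asm) ennreal_le_iff) auto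
  qed
  have hcont: "continuous_on UNIV (h N)" for N
  proof (rule continuous_onI)
    fix x and e :: real assume "e > 0"
    moreover have "dist (h N x') (h N x) \<le> dist x' x" for x'
      using hL[of N x x'] hL[of N x' x] by (auto simp: dist_real_def dist_commute)
    ultimately show "\<exists>d>0. \<forall>x'\<in>UNIV. dist x' x < d \<longrightarrow> dist (h N x') (h N x) \<le> e"
      by (metis less_imp_le order_trans)
  qed
  have hb: "bounded (range (h N))" for N
    using h0 hN by (intro boundedI[of _ "real N"]) auto
  have hm: "h N \<in> borel_measurable borel" for N
    by (rule borel_measurable_continuous_onI[OF hcont])
  have eq: "(\<integral>\<^sup>+x. ennreal (h N x) \<partial>\<mu>) = ennreal (\<integral>x. h N x \<partial>\<mu>)"
    if "\<mu> \<in> borel_prob_measures" for N \<mu>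
  proof (rule nn_integral_eq_integral)
    interpret prob_space \<mu> using that by (simp add: borel_prob_measures_def)
    have [measurable_cong]: "sets \<mu> = sets borel" using that by (simp add: borel_prob_measures_def)
    show "integrable \<mu> (h N)"
      using h0 hN hm by (intro integrable_const_bound[of _ "real N"]) auto
  qed (simp add: h0)
  have N: "(\<integral>\<^sup>+x. ennreal (h N x) \<partial>\<nu>) \<le> liminf (\<lambda>k. \<integral>\<^sup>+x. g x \<partial>\<nu>s k)" for N
  proof -
    have "(\<lambda>k. \<integral>x. h N x \<partial>\<nu>s k) \<longlonglongrightarrow> (\<integral>x. h N x \<partial>\<nu>)"
      using conv hcont hb by (simp add: weakly_converges_def)
    then have "(\<lambda>k. \<integral>\<^sup>+x. ennreal (h N x) \<partial>\<nu>s k) \<longlonglongrightarrow> (\<integral>\<^sup>+x. ennreal (h N x) \<partial>\<nu>)"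
      by (simp add: eq \<nu> \<nu>s)
    then have "(\<integral>\<^sup>+x. ennreal (h N x) \<partial>\<nu>) = liminf (\<lambda>k. \<integral>\<^sup>+x. ennreal (h N x) \<partial>\<nu>s k)"
      by (intro lim_imp_Liminf[symmetric]) auto
    also have "\<dots> \<le> liminf (\<lambda>k. \<integral>\<^sup>+x. g x \<partial>\<nu>s k)"
      by (intro Liminf_mono always_eventually allI nn_integral_mono) (simp add: hg)
    finally show ?thesis .
  qed
  \<comment> \<open>The levels tend to infinity, so this also covers points where \<open>g\<close>
    is infinite.\<close>
  have sup: "g x = (SUP N. ennreal (h N x))" for x
  proof -
    have "(SUP N. min (g x) (of_nat N)) = min (g x) (SUP N. of_nat N)"
      by (simp only: inf_min[symmetric] inf_SUP)
    then show ?thesis by (simp add: hg ennreal_SUP_of_nat_eq_top)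
  qed
  have "(\<integral>\<^sup>+x. g x \<partial>\<nu>) = (\<integral>\<^sup>+x. (SUP N. ennreal (h N x)) \<partial>\<nu>)"
    by (simp add: sup)
  also have "\<dots> = (SUP N. \<integral>\<^sup>+x. ennreal (h N x) \<partial>\<nu>)"
  proof (rule nn_integral_monotone_convergence_SUP)
    show "incseq (\<lambda>N x. ennreal (h N x))"
      by (auto simp: incseq_def le_fun_def hg intro!: min.mono simp del: min.bounded_iff)
    have "sets \<nu> = sets borel" using \<nu> by (simp add: borel_prob_measures_def)
    then show "(\<lambda>x. ennreal (h N x)) \<in> borel_measurable \<nu>" for N
      using hm by (simp cong: measurable_cong_sets)
  qed
  also have "\<dots> \<le> liminf (\<lambda>k. \<integral>\<^sup>+x. g x \<partial>\<nu>s k)"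
    using N by (rule SUP_least)
  finally show ?thesis .
qed

text \<open>The infima of the tails of \<open>\<phi>\<close> inherit the Lipschitz bound, so no tightness is needed.\<close>

lemma weakly_converges_Fatou_Lipschitz:
  fixes \<phi> :: "nat \<Rightarrow> 'a::{metric_space,second_countable_topology} \<Rightarrow> ennreal"
  assumes conv: "weakly_converges \<nu>s \<nu>"
    and \<nu>s: "\<And>k. \<nu>s k \<in> borel_prob_measures" and \<nu>: "\<nu> \<in> borel_prob_measures"
    and \<phi>: "\<And>k x y. \<phi> k x \<le> \<phi> k y + ennreal (dist x y)"
  shows "(\<integral>\<^sup>+x. liminf (\<lambda>k. \<phi> k x) \<partial>\<nu>) \<le> liminf (\<lambda>k. \<integral>\<^sup>+x. \<phi> k x \<partial>\<nu>s k)"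
proof -
  define \<psi> where "\<psi> j x = (INF k\<in>{j..}. \<phi> k x)" for j x
  have L: "\<psi> j x \<le> \<psi> j y + ennreal (dist x y)" for j x y
  proof -
    \<comment> \<open>A function of one variable is viewed as one of a single coordinate, indexed by
      \<open>()\<close>.\<close>
    have "coord_Lipschitz {()} (\<lambda>u. \<phi> k (u ()))" for k
      using \<phi> by (simp add: coord_Lipschitz_def)
    then have "coord_Lipschitz {()} (\<lambda>u. \<psi> j (u ()))"
      unfolding \<psi>_def by (rule coord_Lipschitz_INF)
    from coord_LipschitzD[OF this, of "\<lambda>_. x" "\<lambda>_. y"] show ?thesis by simp
  qed
  have j: "(\<integral>\<^sup>+x. \<psi> j x \<partial>\<nu>) \<le> liminf (\<lambda>k. \<integral>\<^sup>+x. \<phi> k x \<partial>\<nu>s k)" for j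
  proof -
    have "(\<integral>\<^sup>+x. \<psi> j x \<partial>\<nu>) \<le> liminf (\<lambda>k. \<integral>\<^sup>+x. \<psi> j x \<partial>\<nu>s k)"
      by (rule weakly_converges_liminf_Lipschitz[OF conv \<nu>s \<nu> L])
    \<comment> \<open>With \<open>j\<close> fixed, \<open>\<psi> j\<close> lies below
      \<open>\<phi> k\<close> for all \<open>k \<ge> j\<close>.\<close>
    also have "\<dots> \<le> liminf (\<lambda>k. \<integral>\<^sup>+x. \<phi> k x \<partial>\<nu>s k)"
      by (intro Liminf_mono eventually_sequentiallyI[of j] nn_integral_mono)
        (auto simp: \<psi>_def intro: INF_lower)
    finally show ?thesis .
  qed
  have "(\<integral>\<^sup>+x. liminf (\<lambda>k. \<phi> k x) \<partial>\<nu>) = (\<integral>\<^sup>+x. (SUP j. \<psi> j x) \<partial>\<nu>)"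
    by (simp add: liminf_SUP_INF \<psi>_def)
  also have "\<dots> = (SUP j. \<integral>\<^sup>+x. \<psi> j x \<partial>\<nu>)"
  proof (rule nn_integral_monotone_convergence_SUP)
    show "incseq \<psi>"
      by (auto simp: incseq_def le_fun_def \<psi>_def intro!: INF_superset_mono)
    have s: "sets \<nu> = sets borel" using \<nu> by (simp add: borel_prob_measures_def)
    have "coord_Lipschitz {()} (\<lambda>u. \<psi> j (u ()))" for j
      using L by (simp add: coord_Lipschitz_def)
    from coord_Lipschitz_measurable[OF this, of "\<lambda>_ x. x"] s
    show "\<psi> j \<in> borel_measurable \<nu>" for j by (simp cong: measurable_cong_sets)
  qed
  also have "\<dots> \<le> liminf (\<lambda>k. \<integral>\<^sup>+x. \<phi> k x \<partial>\<nu>s k)"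
    using j by (rule SUP_least)
  finally show ?thesis .
qed

lemma coord_Lipschitz_measurable_PiM:
  fixes f :: "('i::countable \<Rightarrow> 'a::{metric_space,second_countable_topology}) \<Rightarrow> ennreal"
  assumes "coord_Lipschitz I f" "finite I" and \<nu>: "\<nu> \<in> borel_prob_measures"
  shows "f \<in> borel_measurable (Pi\<^sub>M I (\<lambda>_. \<nu>))"
proof -
  have s: "sets \<nu> = sets borel" using \<nu> by (simp add: borel_prob_measures_def)
  have "(\<lambda>w. f (\<lambda>i. w i)) \<in> borel_measurable (Pi\<^sub>M I (\<lambda>_. \<nu>))"
    using assms(1,2)
    by (rule coord_Lipschitz_measurable) (use s in \<open>simp cong: measurable_cong_sets\<close>)
  then show ?thesis by simp
qed

text \<open>Coordinates are treated one at a time by Fubini. After the inner integration both the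
  integrand and the outer measure vary with \<open>k\<close>, which calls for the Fatou inequality
  with varying integrands.\<close>

lemma weakly_converges_liminf_PiM:
  fixes f :: "('i::countable \<Rightarrow> 'a::{metric_space,second_countable_topology}) \<Rightarrow> ennreal"
  assumes I: "finite I" and f: "coord_Lipschitz I f"
    and conv: "weakly_converges \<nu>s \<nu>"
    and \<nu>s: "\<And>k. \<nu>s k \<in> borel_prob_measures" and \<nu>: "\<nu> \<in> borel_prob_measures"
  shows "(\<integral>\<^sup>+y. f y \<partial>Pi\<^sub>M I (\<lambda>_. \<nu>)) \<le> liminf (\<lambda>k. \<integral>\<^sup>+y. f y \<partial>Pi\<^sub>M I (\<lambda>_. \<nu>s k))"
  using I f
proof (induction I arbitrary: f)
  case empty
  then show ?case
    by (simp add: PiM_empty nn_integral_count_space_finite Liminf_const)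
next
  case (insert i I)
  have prob: "prob_space (Pi\<^sub>M I (\<lambda>_. \<mu>))" if "\<mu> \<in> borel_prob_measures" for \<mu> :: "'a measure"
    using that by (intro prob_space_PiM) (simp add: borel_prob_measures_def)
  \<comment> \<open>Freezing coordinate \<open>i\<close> at \<open>y\<close> makes its distance term
    zero, so the induction hypothesis applies for each \<open>y\<close>.\<close>
  have fL: "coord_Lipschitz I (\<lambda>x. f (x(i := y)))" for y
    unfolding coord_Lipschitz_def
  proof (intro allI)
    fix u v :: "'i \<Rightarrow> 'a"
    have "(\<Sum>j\<in>insert i I. ennreal (dist ((u(i := y)) j) ((v(i := y)) j)))
        = 0 + (\<Sum>j\<in>I. ennreal (dist (u j) (v j)))"
      using insert.hyps by (subst sum.insert) (auto intro!: sum.cong arg_cong2[of _ _ _ _ "(+)"] simp del: sum_ennreal)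
    then show "f (u(i := y)) \<le> f (v(i := y)) + (\<Sum>j\<in>I. ennreal (dist (u j) (v j)))"
      using coord_LipschitzD[OF insert.prems, of "u(i := y)" "v(i := y)"]
      by (simp del: fun_upd_apply sum_ennreal)
  qed
  define \<Phi> where "\<Phi> \<mu> y = (\<integral>\<^sup>+x. f (x(i := y)) \<partial>Pi\<^sub>M I (\<lambda>_. \<mu>))" for \<mu> y
  have split: "(\<integral>\<^sup>+y. f y \<partial>Pi\<^sub>M (insert i I) (\<lambda>_. \<mu>)) = (\<integral>\<^sup>+y. \<Phi> \<mu> y \<partial>\<mu>)"
    if "\<mu> \<in> borel_prob_measures" for \<mu>
  proof -
    interpret prob_space \<mu> using that by (simp add: borel_prob_measures_def)
    interpret product_sigma_finite "\<lambda>_::'i. \<mu>"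
      by (rule product_sigma_finite.intro) (rule sigma_finite_measure_axioms)
    show ?thesis
      unfolding \<Phi>_def using insert.hyps
      by (intro product_nn_integral_insert_rev coord_Lipschitz_measurable_PiM insert.prems that) auto
  qed
  \<comment> \<open>The partial integral is Lipschitz in the remaining coordinate with constant 1,
    whatever the measure \<open>\<mu>\<close>, hence uniformly along the sequence.\<close>
  have \<Phi>L: "\<Phi> \<mu> x \<le> \<Phi> \<mu> y + ennreal (dist x y)" if "\<mu> \<in> borel_prob_measures" for \<mu> x y
  proof -
    have "coord_Lipschitz {()} (\<lambda>u. f (z(i := u ())))" for z
      unfolding coord_Lipschitz_def
    proof (intro allI)
      fix u v :: "unit \<Rightarrow> 'a"
      have "(\<Sum>j\<in>insert i I. ennreal (dist ((z(i := u ())) j) ((z(i := v ())) j)))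
          = ennreal (dist (u ()) (v ())) + (\<Sum>j\<in>I. 0)"
        using insert.hyps by (subst sum.insert) (auto intro!: sum.cong arg_cong2[of _ _ _ _ "(+)"] simp del: sum_ennreal)
      then show "f (z(i := u ())) \<le> f (z(i := v ())) + (\<Sum>j\<in>{()}. ennreal (dist (u j) (v j)))"
        using coord_LipschitzD[OF insert.prems, of "z(i := u ())" "z(i := v ())"]
        by (simp del: fun_upd_apply sum_ennreal)
    qed
    then have "coord_Lipschitz {()} (\<lambda>u. \<Phi> \<mu> (u ()))"
      unfolding \<Phi>_def
      by (intro coord_Lipschitz_nn_integral prob that coord_Lipschitz_measurable_PiM fL insert.hyps)
    from coord_LipschitzD[OF this, of "\<lambda>_. x" "\<lambda>_. y"] show ?thesis by simp
  qed
  have "(\<integral>\<^sup>+y. f y \<partial>Pi\<^sub>M (insert i I) (\<lambda>_. \<nu>)) = (\<integral>\<^sup>+y. \<Phi> \<nu> y \<partial>\<nu>)"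
    by (rule split[OF \<nu>])
  also have "\<dots> \<le> (\<integral>\<^sup>+y. liminf (\<lambda>k. \<Phi> (\<nu>s k) y) \<partial>\<nu>)"
    \<comment> \<open>The induction hypothesis bounds the inner integral for each value of the new
      coordinate.\<close>
    unfolding \<Phi>_def by (intro nn_integral_mono insert.IH fL)
  also have "\<dots> \<le> liminf (\<lambda>k. \<integral>\<^sup>+y. \<Phi> (\<nu>s k) y \<partial>\<nu>s k)"
    by (rule weakly_converges_Fatou_Lipschitz[OF conv \<nu>s \<nu> \<Phi>L[OF \<nu>s]])
  also have "\<dots> = liminf (\<lambda>k. \<integral>\<^sup>+y. f y \<partial>Pi\<^sub>M (insert i I) (\<lambda>_. \<nu>s k))"
    by (simp add: split[OF \<nu>s])
  finally show ?case .
qed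

subsection \<open>Measurable selection of minimizers\<close>

text \<open>Each direction \<open>b\<close> cuts the set down to its points of least
  \<open>b\<close>-coordinate. Compactness keeps these sets nonempty, and measurability of hitting
  closed sets is the invariant passed along.\<close>

lemma measurable_compact_selection_lex:
  fixes A :: "'w \<Rightarrow> 'a::euclidean_space set"
  assumes B: "finite B"
    and cpt: "\<And>w. w \<in> space M \<Longrightarrow> compact (A w) \<and> A w \<noteq> {}"
    and meas: "\<And>C. closed C \<Longrightarrow> {w \<in> space M. A w \<inter> C \<noteq> {}} \<in> sets M"
  shows "\<exists>A'. (\<forall>w\<in>space M. compact (A' w) \<and> A' w \<noteq> {} \<and> A' w \<subseteq> A w
        \<and> (\<forall>x\<in>A' w. \<forall>y\<in>A' w. \<forall>b\<in>B. x \<bullet> b = y \<bullet> b))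
      \<and> (\<forall>C. closed C \<longrightarrow> {w \<in> space M. A' w \<inter> C \<noteq> {}} \<in> sets M)"
  using B
proof (induction B)
  case empty
  show ?case using cpt meas by (intro exI[of _ A]) simp
next
  case (insert b B)
  from insert.IH obtain A' where 1: "\<forall>w\<in>space M. compact (A' w) \<and> A' w \<noteq> {} \<and> A' w \<subseteq> A w
        \<and> (\<forall>x\<in>A' w. \<forall>y\<in>A' w. \<forall>b\<in>B. x \<bullet> b = y \<bullet> b)"
    and 2: "\<forall>C. closed C \<longrightarrow> {w \<in> space M. A' w \<inter> C \<noteq> {}} \<in> sets M"
    by (elim exE conjE)
  have A': "compact (A' w)" "A' w \<noteq> {}" "A' w \<subseteq> A w"
    "\<And>x y b. x \<in> A' w \<Longrightarrow> y \<in> A' w \<Longrightarrow> b \<in> B \<Longrightarrow> x \<bullet> b = y \<bullet> b" if "w \<in> space M" for w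
    using bspec[OF 1 that] by blast+
  have m': "{w \<in> space M. A' w \<inter> C \<noteq> {}} \<in> sets M" if "closed C" for C
    using 2 that by simp
  define A'' where "A'' w = {x \<in> A' w. \<forall>y\<in>A' w. x \<bullet> b \<le> y \<bullet> b}" for w
  have inner_cont: "continuous_on S (\<lambda>x. x \<bullet> b)" for S
    by (intro continuous_intros)
  have ne: "A'' w \<noteq> {}" if "w \<in> space M" for w
    using continuous_attains_inf[OF A'(1,2)[OF that] inner_cont] by (auto simp: A''_def)
  have "A'' w = A' w \<inter> (\<Inter>y\<in>A' w. {x. x \<bullet> b \<le> y \<bullet> b})" for w by (auto simp: A''_def)
  moreover have "closed {x. x \<bullet> b \<le> c}" for c
    by (intro closed_Collect_le continuous_intros)
  ultimately have cpt'': "compact (A'' w)" if "w \<in> space M" for w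
    using A'(1)[OF that] by (simp add: compact_Int_closed closed_INT)
  have meas'': "{w \<in> space M. A'' w \<inter> C \<noteq> {}} \<in> sets M" if C: "closed C" for C
  proof -
    have half: "closed {x. x \<bullet> b \<le> q}" for q
      by (intro closed_Collect_le continuous_intros)
    define H where "H q = {w \<in> space M. A' w \<inter> {x. x \<bullet> b \<le> q} \<noteq> {}}" for q
    define K where "K q = {w \<in> space M. A' w \<inter> (C \<inter> {x. x \<bullet> b \<le> q}) \<noteq> {}}" for q
    \<comment> \<open>The minimizers meet \<open>C\<close> iff the least \<open>b\<close>-coordinate
      over \<open>A' w \<inter> C\<close> does not exceed that over \<open>A' w\<close>. Testing
      this at rational levels \<open>q\<close> gives a countable intersection.\<close>
    have "{w \<in> space M. A'' w \<inter> C \<noteq> {}}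
        = {w \<in> space M. A' w \<inter> C \<noteq> {}} \<inter> (\<Inter>q\<in>\<rat>. (space M - H q) \<union> K q)" (is "?L = ?R")
    proof (intro set_eqI iffI)
      fix w assume "w \<in> ?L"
      then obtain x where w: "w \<in> space M" and x: "x \<in> A' w" "x \<in> C" "\<And>y. y \<in> A' w \<Longrightarrow> x \<bullet> b \<le> y \<bullet> b"
        by (auto simp: A''_def)
      have "w \<in> K q" if "w \<in> H q" for q
      proof -
        from that obtain y where "y \<in> A' w" "y \<bullet> b \<le> q" by (auto simp: H_def)
        then have "x \<bullet> b \<le> q" using x(3) order_trans by blast
        then show ?thesis using w x(1,2) by (auto simp: K_def)
      qed
      then show "w \<in> ?R" using w x(1,2) by blast
    next
      fix w assume r: "w \<in> ?R"
      then have w: "w \<in> space M" and C': "A' w \<inter> C \<noteq> {}" by auto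
      have "compact (A' w \<inter> C)" using A'(1)[OF w] C by (rule compact_Int_closed)
      from continuous_attains_inf[OF this C' inner_cont] obtain x
        where x: "x \<in> A' w" "x \<in> C" "\<And>y. y \<in> A' w \<Longrightarrow> y \<in> C \<Longrightarrow> x \<bullet> b \<le> y \<bullet> b" by auto
      have "x \<bullet> b \<le> y \<bullet> b" if y: "y \<in> A' w" for y
      proof (rule ccontr)
        assume "\<not> x \<bullet> b \<le> y \<bullet> b"
        \<comment> \<open>A rational strictly between the two minima would be reached by
          \<open>A' w\<close> but not by \<open>A' w \<inter> C\<close>.\<close>
        then obtain q where q: "q \<in> \<rat>" "y \<bullet> b < q" "q < x \<bullet> b"
          using Rats_dense_in_real[of "y \<bullet> b" "x \<bullet> b"] by auto
        have "y \<bullet> b \<le> q" using q by simp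
        then have "w \<in> H q" using y w unfolding H_def by blast
        then have "w \<in> K q" using r q by auto
        then obtain z where "z \<in> A' w" "z \<in> C" "z \<bullet> b \<le> q" by (auto simp: K_def)
        then show False using x(3)[of z] q by simp
      qed
      then show "w \<in> ?L" using w x by (auto simp: A''_def)
    qed
    moreover have "H q \<in> sets M" "K q \<in> sets M" for q
      unfolding H_def K_def by (intro m' half closed_Int C)+
    then have "(\<Inter>q\<in>\<rat>. (space M - H q) \<union> K q) \<in> sets M"
      using Rats_0 by (intro sets.countable_INT'[OF countable_rat]) auto
    ultimately show ?thesis
      using m'[OF C] by simp
  qed
  have eq'': "\<forall>x\<in>A'' w. \<forall>y\<in>A'' w. \<forall>c\<in>insert b B. x \<bullet> c = y \<bullet> c" if "w \<in> space M" for w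
    using A'(4)[OF that] unfolding A''_def by (auto intro!: antisym)
  have sub'': "A'' w \<subseteq> A w" if "w \<in> space M" for w
    using A'(3)[OF that] by (auto simp: A''_def)
  show ?case
    by (intro exI[of _ A''] conjI[OF ballI] allI impI conjI cpt'' ne sub'' eq'' meas'')
qed

text \<open>Once all basis coordinates are fixed, the shrunken set is a singleton, so the selection
  is forced.\<close>

lemma measurable_compact_selection:
  fixes A :: "'w \<Rightarrow> 'a::euclidean_space set"
  assumes cpt: "\<And>w. w \<in> space M \<Longrightarrow> compact (A w) \<and> A w \<noteq> {}"
    and meas: "\<And>C. closed C \<Longrightarrow> {w \<in> space M. A w \<inter> C \<noteq> {}} \<in> sets M"
  obtains s where "s \<in> borel_measurable M" "\<And>w. w \<in> space M \<Longrightarrow> s w \<in> A w"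
proof -
  have "\<exists>A'. (\<forall>w\<in>space M. compact (A' w) \<and> A' w \<noteq> {} \<and> A' w \<subseteq> A w
        \<and> (\<forall>x\<in>A' w. \<forall>y\<in>A' w. \<forall>b\<in>Basis. x \<bullet> b = y \<bullet> b))
      \<and> (\<forall>C. closed C \<longrightarrow> {w \<in> space M. A' w \<inter> C \<noteq> {}} \<in> sets M)"
    by (rule measurable_compact_selection_lex) (use cpt meas in simp_all)
  then obtain A' where 1: "\<forall>w\<in>space M. compact (A' w) \<and> A' w \<noteq> {} \<and> A' w \<subseteq> A w
        \<and> (\<forall>x\<in>A' w. \<forall>y\<in>A' w. \<forall>b\<in>Basis. x \<bullet> b = y \<bullet> b)"
    and 2: "\<forall>C. closed C \<longrightarrow> {w \<in> space M. A' w \<inter> C \<noteq> {}} \<in> sets M"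
    by (elim exE conjE)
  have A': "A' w \<noteq> {}" "A' w \<subseteq> A w"
    "\<And>x y b. x \<in> A' w \<Longrightarrow> y \<in> A' w \<Longrightarrow> b \<in> Basis \<Longrightarrow> x \<bullet> b = y \<bullet> b" if "w \<in> space M" for w
    using bspec[OF 1 that] by blast+
  have m': "{w \<in> space M. A' w \<inter> C \<noteq> {}} \<in> sets M" if "closed C" for C
    using 2 that by simp
  define s where "s w = (SOME x. x \<in> A' w)" for w
  have s: "s w \<in> A' w" if "w \<in> space M" for w
    using A'(1)[OF that] by (auto simp: s_def intro: someI)
  have uniq: "x = s w" if "w \<in> space M" "x \<in> A' w" for w x
    using A'(3)[OF that(1) that(2) s[OF that(1)]] by (rule euclidean_eqI)
  have "s \<in> borel_measurable M"
    unfolding borel_eq_closed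
  proof (rule measurable_measure_of)
    fix C :: "'a set" assume "C \<in> Collect closed"
    then have C: "closed C" by simp
    \<comment> \<open>For singletons, hitting \<open>C\<close> and being mapped into
      \<open>C\<close> coincide; closed sets generate the Borel sets.\<close>
    have "{w \<in> space M. A' w \<inter> C \<noteq> {}} = s -` C \<inter> space M"
      using s uniq by blast
    with m'[OF C] show "s -` C \<inter> space M \<in> sets M" by simp
  qed auto
  then show thesis using that s A'(2) by blast
qed

section \<open>Attainment and measurability of minimizers\<close>

lemma lsc_attains_INF:
  fixes g :: "'a::metric_space \<Rightarrow> ennreal"
  assumes K: "compact K" "K \<noteq> {}"
    and lsc: "\<And>u \<theta>. range u \<subseteq> K \<Longrightarrow> \<theta> \<in> K \<Longrightarrow> u \<longlonglongrightarrow> \<theta> \<Longrightarrow> g \<theta> \<le> liminf (\<lambda>k. g (u k))"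
  obtains \<theta> where "\<theta> \<in> K" "g \<theta> = (INF \<theta>\<in>K. g \<theta>)"
proof -
  \<comment> \<open>The direct method: a minimizing sequence has a convergent subsequence, and lower
    semicontinuity bounds the value at its limit.\<close>
  obtain v where v: "\<And>k. v k \<in> g ` K" "v \<longlonglongrightarrow> (INF \<theta>\<in>K. g \<theta>)"
    using Inf_as_limit[of "g ` K"] K by auto
  then have "\<forall>k. \<exists>\<theta>. \<theta> \<in> K \<and> v k = g \<theta>" by blast
  then obtain u where u: "\<And>k. u k \<in> K" "\<And>k. v k = g (u k)" by metis
  obtain \<theta> r where \<theta>: "\<theta> \<in> K" "strict_mono r" "(u \<circ> r) \<longlonglongrightarrow> \<theta>"
    using K(1) u(1) unfolding compact_eq_seq_compact_metric seq_compact_def by blast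
  have "(\<lambda>k. g ((u \<circ> r) k)) \<longlonglongrightarrow> (INF \<theta>\<in>K. g \<theta>)"
    using LIMSEQ_subseq_LIMSEQ[OF v(2) \<theta>(2)] by (simp add: o_def u(2))
  then have "liminf (\<lambda>k. g ((u \<circ> r) k)) = (INF \<theta>\<in>K. g \<theta>)"
    by (intro lim_imp_Liminf) auto
  moreover have "g \<theta> \<le> liminf (\<lambda>k. g ((u \<circ> r) k))"
    using u(1) \<theta> by (intro lsc) (auto simp: o_def)
  ultimately have "g \<theta> = (INF \<theta>\<in>K. g \<theta>)"
    using INF_lower[OF \<theta>(1), of g] by (intro antisym) auto
  then show thesis using that \<theta>(1) by blast
qed

lemma argmin_set_eq: "argmin_set g K = {\<theta> \<in> K. g \<theta> = (INF \<theta>\<in>K. g \<theta>)}"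
  for g :: "'a \<Rightarrow> 'b::complete_linorder"
proof -
  have "(\<forall>y\<in>K. g \<theta> \<le> g y) \<longleftrightarrow> g \<theta> = (INF \<theta>\<in>K. g \<theta>)" if "\<theta> \<in> K" for \<theta>
    by (metis INF_greatest INF_lower antisym that)
  then show ?thesis
    by (auto simp: argmin_set_def is_arg_min_linorder)
qed

text \<open>Lower semicontinuity in the parameter does not reduce an infimum to a countable dense
  subset, so measurability of the infima is a hypothesis here.\<close>

lemma measurable_argmin_selection:
  fixes G :: "'w \<Rightarrow> 'a::euclidean_space \<Rightarrow> ennreal"
  assumes K: "compact K" "K \<noteq> {}"
    and lsc: "\<And>w u \<theta>. w \<in> space M \<Longrightarrow> range u \<subseteq> K \<Longrightarrow> \<theta> \<in> K \<Longrightarrow> u \<longlonglongrightarrow> \<theta> \<Longrightarrow>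
      G w \<theta> \<le> liminf (\<lambda>k. G w (u k))"
    and meas: "\<And>C. C \<subseteq> K \<Longrightarrow> (\<lambda>w. INF \<theta>\<in>C. G w \<theta>) \<in> borel_measurable M"
  obtains s where "s \<in> borel_measurable M" "\<And>w. w \<in> space M \<Longrightarrow> s w \<in> argmin_set (G w) K"
proof (rule measurable_compact_selection[of M "\<lambda>w. argmin_set (G w) K"])
  fix w assume w: "w \<in> space M"
  have "closed (argmin_set (G w) K)"
    unfolding closed_sequential_limits
  proof (intro allI impI, elim conjE)
    fix u \<theta> assume u: "\<forall>k. u k \<in> argmin_set (G w) K" and lim: "u \<longlonglongrightarrow> \<theta>"
    then have "range u \<subseteq> K" by (auto simp: argmin_set_eq)
    moreover from this have \<theta>: "\<theta> \<in> K"
      using compact_imp_closed[OF K(1)] lim closed_sequentially by blast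
    ultimately have "G w \<theta> \<le> liminf (\<lambda>k. G w (u k))" using lsc w lim by blast
    \<comment> \<open>Along a sequence of minimizers the objective is constant.\<close>
    also have "\<dots> = (INF \<theta>\<in>K. G w \<theta>)"
      using u by (simp add: argmin_set_eq Liminf_const)
    finally show "\<theta> \<in> argmin_set (G w) K"
      using \<theta> by (auto simp: argmin_set_eq intro: antisym INF_lower)
  qed
  moreover have "argmin_set (G w) K \<subseteq> K" by (auto simp: argmin_set_eq)
  moreover have "argmin_set (G w) K \<noteq> {}"
  proof -
    obtain \<theta> where "\<theta> \<in> K" "G w \<theta> = (INF \<theta>\<in>K. G w \<theta>)"
      by (rule lsc_attains_INF[OF K, of "G w"]) (use lsc[OF w] in auto)
    then show ?thesis by (auto simp: argmin_set_eq)
  qed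
  ultimately show "compact (argmin_set (G w) K) \<and> argmin_set (G w) K \<noteq> {}"
    using K(1) by (metis compact_Int_closed inf.absorb_iff2)
next
  fix C :: "'a set" assume C: "closed C"
  show "{w \<in> space M. argmin_set (G w) K \<inter> C \<noteq> {}} \<in> sets M"
  \<comment> \<open>The infimum over the empty set is infinite, so the comparison below would
    wrongly succeed if the objective were infinite on all of \<open>K\<close>.\<close>
  proof (cases "K \<inter> C = {}")
    case True
    then have "{w \<in> space M. argmin_set (G w) K \<inter> C \<noteq> {}} = {}"
      by (auto simp: argmin_set_eq)
    then show ?thesis by (simp only: sets.empty_sets)
  next
    case False
    have KC: "compact (K \<inter> C)" using K(1) C by (rule compact_Int_closed)
    have "argmin_set (G w) K \<inter> C \<noteq> {} \<longleftrightarrow> (INF \<theta>\<in>K \<inter> C. G w \<theta>) \<le> (INF \<theta>\<in>K. G w \<theta>)"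
      if w: "w \<in> space M" for w
    proof
      assume "argmin_set (G w) K \<inter> C \<noteq> {}"
      then obtain \<theta> where "\<theta> \<in> K \<inter> C" "G w \<theta> = (INF \<theta>\<in>K. G w \<theta>)"
        by (auto simp: argmin_set_eq)
      then show "(INF \<theta>\<in>K \<inter> C. G w \<theta>) \<le> (INF \<theta>\<in>K. G w \<theta>)"
        by (metis INF_lower)
    next
      assume le: "(INF \<theta>\<in>K \<inter> C. G w \<theta>) \<le> (INF \<theta>\<in>K. G w \<theta>)"
      \<comment> \<open>Attainment on the compact set \<open>K \<inter> C\<close> turns the
        inequality between infima into an actual minimizer in \<open>C\<close>.\<close>
      obtain \<theta> where \<theta>: "\<theta> \<in> K \<inter> C" "G w \<theta> = (INF \<theta>\<in>K \<inter> C. G w \<theta>)"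
        by (rule lsc_attains_INF[OF KC False, of "G w"]) (use lsc[OF w] in auto)
      with le have "G w \<theta> = (INF \<theta>\<in>K. G w \<theta>)"
        using INF_lower[of \<theta> K "G w"] by (intro antisym) auto
      then show "argmin_set (G w) K \<inter> C \<noteq> {}"
        using \<theta>(1) by (auto simp: argmin_set_eq)
    qed
    then have "{w \<in> space M. argmin_set (G w) K \<inter> C \<noteq> {}}
        = {w \<in> space M. (INF \<theta>\<in>K \<inter> C. G w \<theta>) \<le> (INF \<theta>\<in>K. G w \<theta>)}" by auto
    moreover have "{w \<in> space M. (INF \<theta>\<in>K \<inter> C. G w \<theta>) \<le> (INF \<theta>\<in>K. G w \<theta>)} \<in> sets M"
      by (intro borel_measurable_le meas) auto
    ultimately show ?thesis by (simp only:)
  qed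
qed (use that in blast)

subsection \<open>Minimum smooth Wasserstein estimators\<close>

lemma coord_Lipschitz_smooth_W1_fst:
  fixes \<nu> :: "(real ^ 'd) measure"
  assumes "n \<ge> 1" "\<sigma> > 0"
  shows "coord_Lipschitz {1..n} (\<lambda>x. smooth_W1 \<sigma> (empirical_measure n x) \<nu>)"
  unfolding coord_Lipschitz_def smooth_W1_def
  using W1_empirical_convolution_gaussian_Lipschitz[OF assms] by blast

lemma coord_Lipschitz_smooth_W1_snd:
  fixes \<mu> :: "(real ^ 'd) measure"
  assumes "m \<ge> 1" "\<sigma> > 0"
  shows "coord_Lipschitz {1..m} (\<lambda>y. smooth_W1 \<sigma> \<mu> (empirical_measure m y))"
  using coord_Lipschitz_smooth_W1_fst[OF assms, of \<mu>]
  by (simp add: smooth_W1_def W1_commute)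

text \<open>The Lipschitz bound in the second sample makes the integrand measurable; the bound in
  the first sample passes through the integral.\<close>

lemma coord_Lipschitz_expected_smooth_W1:
  fixes \<nu> :: "(real ^ 'd) measure"
  assumes n: "n \<ge> 1" and m: "m \<ge> 1" and \<sigma>: "\<sigma> > 0" and \<nu>: "\<nu> \<in> borel_prob_measures"
  shows "coord_Lipschitz {1..n} (\<lambda>x. expected_smooth_W1 \<sigma> m (empirical_measure n x) \<nu>)"
  unfolding expected_smooth_W1_def
proof (rule coord_Lipschitz_nn_integral)
  show "prob_space (\<Pi>\<^sub>M i\<in>{1..m}. \<nu>)"
    using \<nu> by (intro prob_space_PiM) (simp add: borel_prob_measures_def)
  show "(\<lambda>y. smooth_W1 \<sigma> (empirical_measure n x) (empirical_measure m y))
      \<in> borel_measurable (\<Pi>\<^sub>M i\<in>{1..m}. \<nu>)" for x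
    by (intro coord_Lipschitz_measurable_PiM coord_Lipschitz_smooth_W1_snd m \<sigma> \<nu>) simp
qed (rule coord_Lipschitz_smooth_W1_fst[OF n \<sigma>])

text \<open>For a test function \<open>h\<close>, the measures whose integral lies in an open set
  form a subbasic open set, so the integral is continuous in the parameter. Sequences suffice, as
  parameters lie in a metric space.\<close>

lemma weak_topology_weakly_converges:
  assumes cont: "continuous_map (top_of_set S) weak_topology Q"
    and u: "range u \<subseteq> S" and \<theta>: "\<theta> \<in> S" and lim: "u \<longlonglongrightarrow> \<theta>"
  shows "weakly_converges (\<lambda>k. Q (u k)) (Q \<theta>)"
  unfolding weakly_converges_def
proof (intro allI impI, elim conjE)
  fix h :: "'b \<Rightarrow> real" assume h: "continuous_on UNIV h" "bounded (range h)"
  have Q: "Q x \<in> borel_prob_measures" if "x \<in> S" for x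
    using continuous_map_image_subset_topspace[OF cont] that by (auto simp: topspace_weak_topology)
  have "continuous_on S (\<lambda>x. \<integral>z. h z \<partial>Q x)"
    unfolding continuous_openin_preimage_eq
  proof (intro allI impI)
    fix U :: "real set" assume "open U"
    with h have "openin weak_topology {\<mu> \<in> borel_prob_measures. (\<integral>z. h z \<partial>\<mu>) \<in> U}"
      unfolding weak_topology_def by (intro topology_generated_by_Basis) blast
    from openin_continuous_map_preimage[OF cont this]
    have "openin (top_of_set S) {x \<in> S. Q x \<in> {\<mu> \<in> borel_prob_measures. (\<integral>z. h z \<partial>\<mu>) \<in> U}}"
      by simp
    also have "{x \<in> S. Q x \<in> {\<mu> \<in> borel_prob_measures. (\<integral>z. h z \<partial>\<mu>) \<in> U}}
        = S \<inter> (\<lambda>x. \<integral>z. h z \<partial>Q x) -` U"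
      using Q by auto
    finally show "openin (top_of_set S) (S \<inter> (\<lambda>x. \<integral>z. h z \<partial>Q x) -` U)" .
  qed
  then show "(\<lambda>k. \<integral>z. h z \<partial>Q (u k)) \<longlonglongrightarrow> (\<integral>z. h z \<partial>Q \<theta>)"
    using u by (intro continuous_on_tendsto_compose[OF _ lim \<theta>]) (auto intro: always_eventually)
qed

theorem theorem5:
  fixes M :: "'w measure"
    and X :: "nat \<Rightarrow> 'w \<Rightarrow> real ^ 'd"
    and P :: "(real ^ 'd) measure"
    and Q :: "real ^ 'p \<Rightarrow> (real ^ 'd) measure"
    and \<Theta> :: "(real ^ 'p) set"
    and \<sigma> :: real
    and m n :: nat
  assumes "\<sigma> > 0"
    and "m \<ge> 1" and "n \<ge> 1"
    and "compact \<Theta>" and "interior \<Theta> \<noteq> {}"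
    and "P \<in> borel_prob_measures" and "integrable P norm"
    and "\<And>\<theta>. \<theta> \<in> \<Theta> \<Longrightarrow> Q \<theta> \<in> borel_prob_measures"
    and "\<And>\<theta>. \<theta> \<in> \<Theta> \<Longrightarrow> integrable (Q \<theta>) norm"
    and "continuous_map (top_of_set \<Theta>) weak_topology Q"
    and "prob_space M"
    and "prob_space.indep_vars M (\<lambda>_. borel) X {1..n}"
    and "\<And>i. i \<in> {1..n} \<Longrightarrow> distr M borel (X i) = P"
  shows "(\<exists>\<theta>hat \<in> borel_measurable M. \<forall>\<omega> \<in> space M.
      \<theta>hat \<omega> \<in> argmin_set
        (\<lambda>\<theta>. expected_smooth_W1 \<sigma> m (empirical_measure n (\<lambda>i. X i \<omega>)) (Q \<theta>)) \<Theta>) \<and>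
    (\<forall>\<omega> \<in> space M. argmin_set
        (\<lambda>\<theta>. expected_smooth_W1 \<sigma> m (empirical_measure n (\<lambda>i. X i \<omega>)) (Q \<theta>)) \<Theta> \<noteq> {})"
proof -
  define G where "G \<omega> \<theta> = expected_smooth_W1 \<sigma> m (empirical_measure n (\<lambda>i. X i \<omega>)) (Q \<theta>)" for \<omega> \<theta>
  have X: "X i \<in> M \<rightarrow>\<^sub>M borel" if "i \<in> {1..n}" for i
    using assms(12) that unfolding prob_space.indep_vars_def[OF assms(11)] by auto
  \<comment> \<open>The data are held fixed: the parameter enters through the product measure only,
    and the integrand is the same along the whole sequence.\<close>
  have lsc: "G \<omega> \<theta> \<le> liminf (\<lambda>k. G \<omega> (u k))"
    if u: "range u \<subseteq> \<Theta>" "\<theta> \<in> \<Theta>" "u \<longlonglongrightarrow> \<theta>" for \<omega> u \<theta>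
    unfolding G_def expected_smooth_W1_def
  proof (rule weakly_converges_liminf_PiM)
    show "weakly_converges (\<lambda>k. Q (u k)) (Q \<theta>)"
      using assms(10) u by (rule weak_topology_weakly_converges)
    show "coord_Lipschitz {1..m}
        (\<lambda>y. smooth_W1 \<sigma> (empirical_measure n (\<lambda>i. X i \<omega>)) (empirical_measure m y))"
      by (rule coord_Lipschitz_smooth_W1_snd[OF assms(2,1)])
  qed (use u assms(8) in auto)
  \<comment> \<open>The bound in the data is uniform over the parameters, so the infimum over any
    \<open>C\<close> is a Lipschitz function of the data and hence measurable in
    \<open>\<omega>\<close>.\<close>
  have meas: "(\<lambda>\<omega>. INF \<theta>\<in>C. G \<omega> \<theta>) \<in> borel_measurable M" if "C \<subseteq> \<Theta>" for C
    unfolding G_def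
  proof (rule coord_Lipschitz_measurable[where f =
        "\<lambda>x. INF \<theta>\<in>C. expected_smooth_W1 \<sigma> m (empirical_measure n x) (Q \<theta>)" and I = "{1..n}"])
    show "coord_Lipschitz {1..n}
        (\<lambda>x. INF \<theta>\<in>C. expected_smooth_W1 \<sigma> m (empirical_measure n x) (Q \<theta>))"
      using that
      by (intro coord_Lipschitz_INF coord_Lipschitz_expected_smooth_W1 assms(1-3,8)) auto
  qed (use X in auto)
  have "\<Theta> \<noteq> {}" using assms(5) by auto
  then obtain s where "s \<in> borel_measurable M" "\<And>\<omega>. \<omega> \<in> space M \<Longrightarrow> s \<omega> \<in> argmin_set (G \<omega>) \<Theta>"
    using measurable_argmin_selection[OF assms(4), of M G] lsc meas by blast
  then show ?thesis unfolding G_def by blast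
qed

end
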